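(* Let $D$ be a loose $k$-partite tournament ($k\ge3$), let $X_1$ be a partite set of $D$ that is not $\{1,2\}$-competing, and let $X_2,\dots,X_k$ be the remaining partite sets, labeled so that: for every anti-$\{1,2\}$-competing set $S\subseteq X_1$ containing at least two non-sink vertices, every non-sink vertex of $S$ has all of its out-neighbors in $X_2$. For $2\le i\le k$ let $F_i=\{v\in V(D): \emptyset\ne N^+(v)\subseteq X_i\}$. Then: (1) $F_i\subseteq X_1$ for every $2\le i\le k$; (2) $\bigcup_{i=3}^k X_i$ is a clique in $C_{1,2}(D)$, and every vertex of $\bigcup_{i=3}^k X_i$ is adjacent in $C_{1,2}(D)$ to every vertex of $X_2$; (3) for distinct $i,j\in\{2,\dots,k\}$, every vertex of $F_i$ is adjacent in $C_{1,2}(D)$ to every vertex of $F_j\cup X_j$; (4) for $i\in\{2,\dots,k\}$, a non-sink vertex $x$ with $N^+(x)\subseteq X_i$, and a vertex $y\in X_i$: $x$ and $y$ are not adjacent in $C_{1,2}(D)$ if and only if $N^+(x)=\{y\}$ or $N^+(y)=\{x\}$; (5) if $D$ has a sink or $X_1$ contains an anti-$\{1,2\}$-competing set of size at least three, then $V(D)\setminus X_1$ is a clique in $C_{1,2}(D)$.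
   Context: All graphs and digraphs are finite and simple. For a digraph $D$ and a vertex $v$, $N^+(v)$ is the out-neighborhood of $v$; a sink is a vertex of outdegree $0$. $d_D(x,y)$ is the length of a shortest directed path from $x$ to $y$ in $D$. The $(1,2)$-step competition graph $C_{1,2}(D)$ is the graph on $V(D)$ in which distinct $u,v$ are adjacent iff there is a vertex $w\notin\{u,v\}$ with either $d_{D-v}(u,w)\le 1$ and $d_{D-u}(v,w)\le 2$, or $d_{D-u}(v,w)\le 1$ and $d_{D-v}(u,w)\le 2$. A $k$-partite tournament is an orientation of a complete $k$-partite graph (with $k$ nonempty partite sets); a multipartite tournament is one with $k\ge 3$. A set of vertices is $\{1,2\}$-competing if it is a clique in $C_{1,2}(D)$, anti-$\{1,2\}$-competing if it is a stable set in $C_{1,2}(D)$. A multipartite tournament is loose if some partite set is not $\{1,2\}$-competing. *)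

theory Defs
  imports "Graph_Theory.Graph_Theory"
begin

definition out_nbrs :: "('a, 'b) pre_digraph \<Rightarrow> 'a \<Rightarrow> 'a set" where
  "out_nbrs D v = {w. v \<rightarrow>\<^bsub>D\<^esub> w}"

definition sink :: "('a, 'b) pre_digraph \<Rightarrow> 'a \<Rightarrow> bool" where
  "sink D v \<longleftrightarrow> v \<in> verts D \<and> out_degree D v = 0"

definition ddist :: "('a, 'b) pre_digraph \<Rightarrow> 'a \<Rightarrow> 'a \<Rightarrow> ereal" where
  "ddist D x y = wf_digraph.\<mu> D (\<lambda>_. 1) x y"

text \<open>
  As in \<^theory>\<open>Graph_Theory.Digraph\<close>, an undirected simple graph is a loop-free symmetric
  digraph; here its arcs are pairs of vertices.
\<close>

definition C12 :: "('a, 'b) pre_digraph \<Rightarrow> 'a pair_pre_digraph" where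
  "C12 D = \<lparr> pverts = verts D,
     parcs = {(u, v). u \<in> verts D \<and> v \<in> verts D \<and> u \<noteq> v \<and>
       (\<exists>w \<in> verts D - {u, v}.
          ddist (pre_digraph.del_vert D v) u w \<le> 1 \<and> ddist (pre_digraph.del_vert D u) v w \<le> 2 \<or>
          ddist (pre_digraph.del_vert D u) v w \<le> 1 \<and> ddist (pre_digraph.del_vert D v) u w \<le> 2)} \<rparr>"

definition clique :: "('a, 'b) pre_digraph \<Rightarrow> 'a set \<Rightarrow> bool" where
  "clique G K \<longleftrightarrow> K \<subseteq> verts G \<and> (\<forall>u \<in> K. \<forall>v \<in> K. u \<noteq> v \<longrightarrow> u \<rightarrow>\<^bsub>G\<^esub> v)"

definition stable_set :: "('a, 'b) pre_digraph \<Rightarrow> 'a set \<Rightarrow> bool" where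
  "stable_set G S \<longleftrightarrow> S \<subseteq> verts G \<and> (\<forall>u \<in> S. \<forall>v \<in> S. \<not> u \<rightarrow>\<^bsub>G\<^esub> v)"

definition competing12 :: "('a, 'b) pre_digraph \<Rightarrow> 'a set \<Rightarrow> bool" where
  "competing12 D S \<longleftrightarrow> clique (C12 D) S"

definition anti_competing12 :: "('a, 'b) pre_digraph \<Rightarrow> 'a set \<Rightarrow> bool" where
  "anti_competing12 D S \<longleftrightarrow> stable_set (C12 D) S"

definition complete_partite :: "nat \<Rightarrow> (nat \<Rightarrow> 'a set) \<Rightarrow> 'a pair_pre_digraph" where
  "complete_partite k X = \<lparr> pverts = (\<Union>i\<in>{1..k}. X i),
     parcs = {(u, v). \<exists>i\<in>{1..k}. \<exists>j\<in>{1..k}. i \<noteq> j \<and> u \<in> X i \<and> v \<in> X j} \<rparr>"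

definition orientation_of :: "('a, 'b) pre_digraph \<Rightarrow> ('a, 'c) pre_digraph \<Rightarrow> bool" where
  "orientation_of D G \<longleftrightarrow> digraph D \<and> verts D = verts G \<and>
     (\<forall>u v. u \<rightarrow>\<^bsub>D\<^esub> v \<longrightarrow> u \<rightarrow>\<^bsub>G\<^esub> v) \<and>
     (\<forall>u v. u \<rightarrow>\<^bsub>G\<^esub> v \<longrightarrow> (u \<rightarrow>\<^bsub>D\<^esub> v) \<noteq> (v \<rightarrow>\<^bsub>D\<^esub> u))"

text \<open>The partite sets are \<open>X 1, \<dots>, X k\<close>; the values of \<open>X\<close> at other indices play no role.\<close>

definition partite_tournament :: "nat \<Rightarrow> (nat \<Rightarrow> 'a set) \<Rightarrow> ('a, 'b) pre_digraph \<Rightarrow> bool" where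
  "partite_tournament k X D \<longleftrightarrow>
     (\<forall>i\<in>{1..k}. X i \<noteq> {}) \<and> disjoint_family_on X {1..k} \<and>
     orientation_of D (complete_partite k X)"

definition multipartite_tournament :: "nat \<Rightarrow> (nat \<Rightarrow> 'a set) \<Rightarrow> ('a, 'b) pre_digraph \<Rightarrow> bool" where
  "multipartite_tournament k X D \<longleftrightarrow> k \<ge> 3 \<and> partite_tournament k X D"

definition loose :: "nat \<Rightarrow> (nat \<Rightarrow> 'a set) \<Rightarrow> ('a, 'b) pre_digraph \<Rightarrow> bool" where
  "loose k X D \<longleftrightarrow> multipartite_tournament k X D \<and> (\<exists>i\<in>{1..k}. \<not> competing12 D (X i))"

definition F_set :: "('a, 'b) pre_digraph \<Rightarrow> 'a set \<Rightarrow> 'a set" where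
  "F_set D A = {v \<in> verts D. out_nbrs D v \<noteq> {} \<and> out_nbrs D v \<subseteq> A}"

lemma pair_graph_C12:
  assumes "digraph D"
  shows "pair_graph (C12 D)"
proof -
  interpret D: digraph D by (rule assms)
  have "finite (parcs (C12 D))"
    by (rule finite_subset[of _ "verts D \<times> verts D"]) (auto simp: C12_def)
  then show ?thesis
    by unfold_locales (auto simp: C12_def symmetric_def sym_def arcs_ends_conv insert_commute)
qed

text \<open>
  \<open>\<mu>\<close> is an infimum over walks; with unit costs it is attained by a path, so \<open>ddist\<close> is the
  length of a shortest directed path.
\<close>

lemma ddist_le_iff:
  assumes "digraph D"
  shows "ddist D x y \<le> ereal (real n) \<longleftrightarrow> (\<exists>p. pre_digraph.apath D x p y \<and> length p \<le> n)"
proof -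
  interpret D: digraph D by (rule assms)
  have cost: "D.awalk_cost (\<lambda>_. 1) p = real (length p)" for p :: "'b list"
    by (induct p) auto
  show ?thesis
  proof
    assume le: "ddist D x y \<le> ereal (real n)"
    have "x \<rightarrow>\<^sup>*\<^bsub>D\<^esub> y"
      using le D.shortest_path_inf[of x y "\<lambda>_. 1"] unfolding ddist_def by fastforce
    then obtain p where "D.apath x p y" "D.\<mu> (\<lambda>_. 1) x y = ereal (D.awalk_cost (\<lambda>_. 1) p)"
      using D.min_cost_awalk[of x y "\<lambda>_. 1"] by auto
    then show "\<exists>p. D.apath x p y \<and> length p \<le> n"
      using le by (auto simp: ddist_def cost)
  next
    assume "\<exists>p. D.apath x p y \<and> length p \<le> n"
    then obtain p where p: "D.apath x p y" "length p \<le> n" by auto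
    have "D.\<mu> (\<lambda>_. 1) x y \<le> ereal (D.awalk_cost (\<lambda>_. 1) p)"
      using p by (intro D.min_cost_le_walk_cost D.awalkI_apath)
    also have "\<dots> \<le> ereal (real n)" using p(2) by (simp add: cost)
    finally show "ddist D x y \<le> ereal (real n)" by (simp add: ddist_def)
  qed
qed

end

theory Submission
  imports Defs
begin

text \<open>
  Vertices \<open>u\<close> and \<open>v\<close> are adjacent in \<open>C\<^sub>1\<^sub>,\<^sub>2(D)\<close> iff some \<open>a \<in> N\<^sup>+(u) - {v}\<close> and
  \<open>b \<in> N\<^sup>+(v) - {u}\<close> are equal or joined by an arc. In a multipartite tournament, it is therefore
  enough to find such \<open>a\<close> and \<open>b\<close> in different partite sets, or a common out-neighbor.
  As \<open>X 1\<close> is not \<open>{1,2}\<close>-competing, it contains two vertices with disjoint out-neighborhoods, and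
  by the labeling both out-neighborhoods lie in \<open>X 2\<close> unless one of the vertices is a sink. This
  yields \<open>p, q \<in> X 1\<close> (with \<open>p = q\<close> if one of them is a sink) such that every vertex outside \<open>X 1\<close>
  dominates \<open>p\<close> or \<open>q\<close>, and every vertex outside \<open>X 1 \<union> X 2\<close> dominates both.
\<close>

lemma mem_out_nbrs_iff: "w \<in> out_nbrs D v \<longleftrightarrow> v \<rightarrow>\<^bsub>D\<^esub> w"
  by (simp add: out_nbrs_def)

lemma verts_C12: "verts (C12 D) = verts D"
  by (simp add: C12_def)

context digraph
begin

lemma digraph_del_vert: "digraph (del_vert u)"
  by (rule digraph_subgraph[OF subgraph_del_vert])

lemma dominates_del_vert_iff: "x \<rightarrow>\<^bsub>del_vert u\<^esub> y \<longleftrightarrow> x \<rightarrow>\<^bsub>G\<^esub> y \<and> x \<noteq> u \<and> y \<noteq> u"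
  by (auto simp: arcs_ends_conv del_vert_simps)

lemma sink_iff_out_nbrs: "sink G v \<longleftrightarrow> v \<in> verts G \<and> out_nbrs G v = {}"
proof -
  have "out_degree G v = 0 \<longleftrightarrow> out_arcs G v = {}"
    by (simp add: out_degree_def out_arcs_def)
  also have "\<dots> \<longleftrightarrow> out_nbrs G v = {}"
    by (auto simp: out_nbrs_def arcs_ends_conv out_arcs_def)
  finally show ?thesis by (auto simp: sink_def)
qed

lemma ddist_le_iff_awalk:
  "ddist G x y \<le> ereal (real n) \<longleftrightarrow> (\<exists>p. awalk x p y \<and> length p \<le> n)"
proof
  assume "ddist G x y \<le> ereal (real n)"
  then show "\<exists>p. awalk x p y \<and> length p \<le> n"
    using ddist_le_iff[OF digraph_axioms] awalkI_apath by blast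
next
  assume "\<exists>p. awalk x p y \<and> length p \<le> n"
  then obtain p where p: "awalk x p y" "length p \<le> n" by blast
  have "awalk_cost (\<lambda>_. 1) q = real (length q)" for q :: "'b list"
    by (induction q) auto
  then have "ddist G x y \<le> ereal (real (length p))"
    using min_cost_le_walk_cost[OF p(1), of "\<lambda>_. 1"] by (simp add: ddist_def)
  also have "\<dots> \<le> ereal (real n)"
    using p(2) by simp
  finally show "ddist G x y \<le> ereal (real n)" .
qed

lemma ddist_le_0_iff: "ddist G x y \<le> 0 \<longleftrightarrow> x = y \<and> x \<in> verts G"
  using ddist_le_iff_awalk[of x y 0] by (auto simp: awalk_Nil_iff zero_ereal_def)

lemma ddist_le_Suc_iff:
  "ddist G x y \<le> ereal (real (Suc n)) \<longleftrightarrow>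
    ddist G x y \<le> 0 \<or> (\<exists>z. x \<rightarrow>\<^bsub>G\<^esub> z \<and> ddist G z y \<le> ereal (real n))"
proof -
  have ex_list_iff: "(\<exists>p. P p) \<longleftrightarrow> P [] \<or> (\<exists>e p. P (e # p))" for P :: "'b list \<Rightarrow> bool"
    by (metis list.exhaust)
  have "ddist G x y \<le> ereal (real (Suc n)) \<longleftrightarrow>
      awalk x [] y \<or> (\<exists>e p. awalk x (e # p) y \<and> length p \<le> n)"
    unfolding ddist_le_iff_awalk by (subst ex_list_iff) simp
  also have "\<dots> \<longleftrightarrow> ddist G x y \<le> 0 \<or> (\<exists>z. x \<rightarrow>\<^bsub>G\<^esub> z \<and> ddist G z y \<le> ereal (real n))"
    by (auto simp: awalk_simps arcs_ends_conv ddist_le_iff_awalk ddist_le_0_iff)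
  finally show ?thesis .
qed

lemma ddist_le_1_iff: "ddist G x y \<le> 1 \<longleftrightarrow> x = y \<and> x \<in> verts G \<or> x \<rightarrow>\<^bsub>G\<^esub> y"
  using ddist_le_Suc_iff[of x y 0] adj_in_verts(2)
  by (auto simp: ddist_le_0_iff simp flip: one_ereal_def zero_ereal_def)

lemma ddist_le_2_iff:
  "ddist G x y \<le> 2 \<longleftrightarrow>
    x = y \<and> x \<in> verts G \<or> x \<rightarrow>\<^bsub>G\<^esub> y \<or> (\<exists>z. x \<rightarrow>\<^bsub>G\<^esub> z \<and> z \<rightarrow>\<^bsub>G\<^esub> y)"
proof -
  have "ddist G x y \<le> 2 \<longleftrightarrow> ddist G x y \<le> 0 \<or> (\<exists>z. x \<rightarrow>\<^bsub>G\<^esub> z \<and> ddist G z y \<le> 1)"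
    using ddist_le_Suc_iff[of x y 1] by (simp add: one_ereal_def)
  then show ?thesis
    using adj_in_verts(2) unfolding ddist_le_0_iff ddist_le_1_iff by blast
qed

lemma ddist_del_vert_le_1_2_iff:
  assumes "u \<noteq> v"
  shows "(\<exists>w\<in>verts G - {u, v}. ddist (del_vert v) u w \<le> 1 \<and> ddist (del_vert u) v w \<le> 2) \<longleftrightarrow>
    (\<exists>a\<in>out_nbrs G u - {v}. \<exists>b\<in>out_nbrs G v - {u}. a = b \<or> b \<rightarrow>\<^bsub>G\<^esub> a)"
proof -
  have le_1: "ddist (del_vert v) u w \<le> 1 \<longleftrightarrow> u \<rightarrow>\<^bsub>G\<^esub> w" if "w \<in> verts G - {u, v}" for w
    using digraph.ddist_le_1_iff[OF digraph_del_vert, of v u w] that assms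
    by (auto simp: dominates_del_vert_iff)
  have le_2: "ddist (del_vert u) v w \<le> 2 \<longleftrightarrow> (\<exists>b\<in>out_nbrs G v - {u}. w = b \<or> b \<rightarrow>\<^bsub>G\<^esub> w)"
    if "w \<in> verts G - {u, v}" for w
    using digraph.ddist_le_2_iff[OF digraph_del_vert, of u v w] that assms
    by (auto simp: dominates_del_vert_iff mem_out_nbrs_iff)
  have out_nbrs_eq: "out_nbrs G u - {v} = {w \<in> verts G - {u, v}. u \<rightarrow>\<^bsub>G\<^esub> w}"
    using adj_in_verts(2) adj_not_same by (auto simp: mem_out_nbrs_iff)
  have "(\<exists>w\<in>verts G - {u, v}. ddist (del_vert v) u w \<le> 1 \<and> ddist (del_vert u) v w \<le> 2) \<longleftrightarrow>
      (\<exists>a\<in>verts G - {u, v}. u \<rightarrow>\<^bsub>G\<^esub> a \<and> (\<exists>b\<in>out_nbrs G v - {u}. a = b \<or> b \<rightarrow>\<^bsub>G\<^esub> a))"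
    by (intro bex_cong refl) (simp only: le_1 le_2)
  also have "\<dots> \<longleftrightarrow> (\<exists>a\<in>out_nbrs G u - {v}. \<exists>b\<in>out_nbrs G v - {u}. a = b \<or> b \<rightarrow>\<^bsub>G\<^esub> a)"
    unfolding out_nbrs_eq by (simp add: Bex_def)
  finally show ?thesis .
qed

lemma C12_adj_iff:
  "u \<rightarrow>\<^bsub>C12 G\<^esub> v \<longleftrightarrow>
    u \<noteq> v \<and> (\<exists>a\<in>out_nbrs G u - {v}. \<exists>b\<in>out_nbrs G v - {u}. a = b \<or> a \<rightarrow>\<^bsub>G\<^esub> b \<or> b \<rightarrow>\<^bsub>G\<^esub> a)"
proof -
  have in_verts: "x \<in> verts G" if "a \<in> out_nbrs G x - {y}" for a x y
    using that adj_in_verts(1) by (auto simp: mem_out_nbrs_iff)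
  have "u \<rightarrow>\<^bsub>C12 G\<^esub> v \<longleftrightarrow> u \<in> verts G \<and> v \<in> verts G \<and> u \<noteq> v \<and>
      ((\<exists>w\<in>verts G - {u, v}. ddist (del_vert v) u w \<le> 1 \<and> ddist (del_vert u) v w \<le> 2) \<or>
       (\<exists>w\<in>verts G - {v, u}. ddist (del_vert u) v w \<le> 1 \<and> ddist (del_vert v) u w \<le> 2))"
    by (simp add: C12_def arcs_ends_conv bex_disj_distrib insert_commute)
  also have "\<dots> \<longleftrightarrow> u \<in> verts G \<and> v \<in> verts G \<and> u \<noteq> v \<and>
      ((\<exists>a\<in>out_nbrs G u - {v}. \<exists>b\<in>out_nbrs G v - {u}. a = b \<or> b \<rightarrow>\<^bsub>G\<^esub> a) \<or>
       (\<exists>b\<in>out_nbrs G v - {u}. \<exists>a\<in>out_nbrs G u - {v}. b = a \<or> a \<rightarrow>\<^bsub>G\<^esub> b))"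
    using ddist_del_vert_le_1_2_iff[of u v] ddist_del_vert_le_1_2_iff[of v u]
    by (intro conj_cong refl arg_cong2[of _ _ _ _ "(\<or>)"]) auto
  also have "\<dots> \<longleftrightarrow>
      u \<noteq> v \<and> (\<exists>a\<in>out_nbrs G u - {v}. \<exists>b\<in>out_nbrs G v - {u}. a = b \<or> a \<rightarrow>\<^bsub>G\<^esub> b \<or> b \<rightarrow>\<^bsub>G\<^esub> a)"
    using in_verts[of _ u v] in_verts[of _ v u] by blast
  finally show ?thesis .
qed

lemma C12_adj_if_common_out_nbr:
  assumes "u \<noteq> v" "u \<rightarrow>\<^bsub>G\<^esub> w" "v \<rightarrow>\<^bsub>G\<^esub> w"
  shows "u \<rightarrow>\<^bsub>C12 G\<^esub> v"
proof -
  have "w \<in> out_nbrs G u - {v}" "w \<in> out_nbrs G v - {u}"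
    using assms(2,3) adj_not_same by (auto simp: mem_out_nbrs_iff)
  with assms(1) show ?thesis
    unfolding C12_adj_iff by blast
qed

lemma clique_C12_if_common_out_nbr:
  assumes "K \<subseteq> verts G" "\<And>u v. u \<in> K \<Longrightarrow> v \<in> K \<Longrightarrow> \<exists>w. u \<rightarrow>\<^bsub>G\<^esub> w \<and> v \<rightarrow>\<^bsub>G\<^esub> w"
  shows "clique (C12 G) K"
  using assms C12_adj_if_common_out_nbr unfolding clique_def verts_C12 by blast

lemma anti_competing12_pair_iff:
  "anti_competing12 G {p, q} \<longleftrightarrow> p \<in> verts G \<and> q \<in> verts G \<and> \<not> p \<rightarrow>\<^bsub>C12 G\<^esub> q"
  unfolding anti_competing12_def stable_set_def verts_C12 C12_adj_iff by blast

end

locale partite_tournament_digraph =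
  fixes D :: "('a, 'b) pre_digraph" and k :: nat and X :: "nat \<Rightarrow> 'a set"
  assumes partite_tournament: "partite_tournament k X D"
begin

sublocale digraph D
  using partite_tournament by (simp add: partite_tournament_def orientation_of_def)

lemma verts_eq_Union_parts: "verts D = (\<Union>i\<in>{1..k}. X i)"
  using partite_tournament
  by (simp add: partite_tournament_def orientation_of_def complete_partite_def)

lemma part_subset_verts:
  assumes "i \<in> {1..k}"
  shows "X i \<subseteq> verts D"
  using assms unfolding verts_eq_Union_parts by blast

lemma part_subset_verts_diff_part:
  assumes "i \<in> {1..k}" "j \<in> {1..k}" "i \<noteq> j"
  shows "X i \<subseteq> verts D - X j"
  using assms partite_tournament part_subset_verts
  unfolding partite_tournament_def disjoint_family_on_def by blast

lemma complete_partite_adj_iff: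
  "u \<rightarrow>\<^bsub>complete_partite k X\<^esub> v \<longleftrightarrow>
    (\<exists>i\<in>{1..k}. \<exists>j\<in>{1..k}. i \<noteq> j \<and> u \<in> X i \<and> v \<in> X j)"
  by (simp add: complete_partite_def arcs_ends_conv)

lemma adj_diff_parts:
  assumes "u \<rightarrow>\<^bsub>D\<^esub> v"
  obtains i j where "i \<in> {1..k}" "j \<in> {1..k}" "i \<noteq> j" "u \<in> X i" "v \<in> X j"
  using assms partite_tournament complete_partite_adj_iff
  unfolding partite_tournament_def orientation_of_def by metis

lemma diff_parts_adj_iff:
  assumes "i \<in> {1..k}" "j \<in> {1..k}" "i \<noteq> j" "u \<in> X i" "v \<in> X j"
  shows "u \<rightarrow>\<^bsub>D\<^esub> v \<longleftrightarrow> \<not> v \<rightarrow>\<^bsub>D\<^esub> u"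
  using assms partite_tournament complete_partite_adj_iff
  unfolding partite_tournament_def orientation_of_def by metis

lemma adj_asym: "u \<rightarrow>\<^bsub>D\<^esub> v \<Longrightarrow> \<not> v \<rightarrow>\<^bsub>D\<^esub> u"
  using adj_diff_parts diff_parts_adj_iff by metis

lemma out_nbrs_subset_verts_diff_part:
  assumes "i \<in> {1..k}" "v \<in> X i"
  shows "out_nbrs D v \<subseteq> verts D - X i"
proof
  fix w assume "w \<in> out_nbrs D v"
  then have "v \<rightarrow>\<^bsub>D\<^esub> w" by (simp add: mem_out_nbrs_iff)
  then show "w \<in> verts D - X i"
    using assms part_subset_verts_diff_part by (elim adj_diff_parts) blast
qed

lemma adj_to_part_iff:
  assumes "i \<in> {1..k}" "p \<in> X i" "v \<in> verts D - X i"
  shows "v \<rightarrow>\<^bsub>D\<^esub> p \<longleftrightarrow> v \<notin> out_nbrs D p"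
proof -
  obtain j where j: "j \<in> {1..k}" "v \<in> X j" "j \<noteq> i"
    using assms(3) unfolding verts_eq_Union_parts by blast
  show ?thesis
    unfolding mem_out_nbrs_iff by (rule diff_parts_adj_iff[OF j(1) assms(1) j(3,2) assms(2)])
qed

lemma C12_adj_if_out_nbrs_diff_parts:
  assumes "u \<noteq> v" "i \<in> {1..k}" "a \<in> out_nbrs D u - {v}" "a \<in> X i"
    and "b \<in> out_nbrs D v - {u}" "b \<in> verts D - X i"
  shows "u \<rightarrow>\<^bsub>C12 D\<^esub> v"
  using assms adj_to_part_iff[of i a b] unfolding C12_adj_iff mem_out_nbrs_iff by blast

lemma nonadjacent_in_part_dominated:
  assumes "i \<in> {1..k}" "p \<in> X i" "q \<in> X i" "p \<noteq> q" "\<not> p \<rightarrow>\<^bsub>C12 D\<^esub> q" "v \<in> verts D - X i"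
  shows "v \<rightarrow>\<^bsub>D\<^esub> p \<or> v \<rightarrow>\<^bsub>D\<^esub> q"
  using assms C12_adj_if_common_out_nbr[of p q v] adj_to_part_iff
  by (auto simp: mem_out_nbrs_iff)

lemma clique_verts_diff_part_if_sink:
  assumes "i \<in> {1..k}" "sink D s" "s \<in> X i"
  shows "clique (C12 D) (verts D - X i)"
  using assms adj_to_part_iff[of i s]
  by (intro clique_C12_if_common_out_nbr) (auto simp: sink_iff_out_nbrs)

lemma sink_in_noncompeting_part:
  assumes "i \<in> {1..k}" "\<not> competing12 D (X i)" "sink D s"
  shows "s \<in> X i"
proof (rule ccontr)
  assume "s \<notin> X i"
  then obtain j where j: "j \<in> {1..k}" "s \<in> X j" "j \<noteq> i"
    using assms(3) unfolding sink_iff_out_nbrs verts_eq_Union_parts by blast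
  then have "X i \<subseteq> verts D - X j"
    using part_subset_verts_diff_part assms(1) by blast
  then have "competing12 D (X i)"
    using clique_verts_diff_part_if_sink[OF j(1) assms(3) j(2)]
    by (auto simp: competing12_def clique_def)
  with assms(2) show False ..
qed

lemma clique_verts_diff_part_if_anti_competing:
  assumes "i \<in> {1..k}" "S \<subseteq> X i" "anti_competing12 D S" "card S \<ge> 3"
  shows "clique (C12 D) (verts D - X i)"
proof (rule clique_C12_if_common_out_nbr)
  obtain T where T: "T \<subseteq> S" "card T = 3"
    using obtain_subset_with_card_n[OF assms(4)] by metis
  then obtain p q r where pqr: "T = {p, q, r}" "p \<noteq> q" "p \<noteq> r" "q \<noteq> r"
    by (metis card_3_iff)
  have members: "p \<in> X i" "q \<in> X i" "r \<in> X i"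
    using assms(2) T(1) pqr(1) by auto
  have "\<not> p \<rightarrow>\<^bsub>C12 D\<^esub> q" "\<not> p \<rightarrow>\<^bsub>C12 D\<^esub> r" "\<not> q \<rightarrow>\<^bsub>C12 D\<^esub> r"
    using assms(3) T(1) pqr(1) by (auto simp: anti_competing12_def stable_set_def)
  then have dominates_two: "v \<rightarrow>\<^bsub>D\<^esub> p \<or> v \<rightarrow>\<^bsub>D\<^esub> q"
     "v \<rightarrow>\<^bsub>D\<^esub> p \<or> v \<rightarrow>\<^bsub>D\<^esub> r" "v \<rightarrow>\<^bsub>D\<^esub> q \<or> v \<rightarrow>\<^bsub>D\<^esub> r"
    if "v \<in> verts D - X i" for v
    using nonadjacent_in_part_dominated[OF assms(1) _ _ _ _ that] members pqr(2-4) by blast+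
  fix u v assume "u \<in> verts D - X i" "v \<in> verts D - X i"
  then show "\<exists>w. u \<rightarrow>\<^bsub>D\<^esub> w \<and> v \<rightarrow>\<^bsub>D\<^esub> w"
    using dominates_two[of u] dominates_two[of v] by blast
qed auto

end

locale labeled_loose = partite_tournament_digraph +
  assumes k_pos: "k \<ge> 1"
    and not_competing_X1: "\<not> competing12 D (X 1)"
    and labeling: "\<And>S v. \<lbrakk>S \<subseteq> X 1; anti_competing12 D S; card {u \<in> S. \<not> sink D u} \<ge> 2;
           v \<in> S; \<not> sink D v\<rbrakk> \<Longrightarrow> out_nbrs D v \<subseteq> X 2"
begin

lemma one_is_part_index: "1 \<in> {1..k}"
  using k_pos by simp

lemma part_subset_verts_diff_X1:
  assumes "i \<in> {2..k}"
  shows "X i \<subseteq> verts D - X 1"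
  using assms by (intro part_subset_verts_diff_part) auto

lemma Union_parts_from_3_subset: "(\<Union>i\<in>{3..k}. X i) \<subseteq> verts D - X 1 - X 2"
proof (rule UN_least)
  fix i assume "i \<in> {3..k}"
  then show "X i \<subseteq> verts D - X 1 - X 2"
    using part_subset_verts_diff_part[of i 1] part_subset_verts_diff_part[of i 2] by auto
qed

lemma disjoint_out_nbrs_pair:
  obtains p q where "p \<in> X 1" "q \<in> X 1"
    and "out_nbrs D p \<inter> out_nbrs D q = {}" "out_nbrs D p \<union> out_nbrs D q \<subseteq> X 2"
proof -
  have verts: "X 1 \<subseteq> verts D"
    using part_subset_verts[OF one_is_part_index] .
  obtain p q where pq: "p \<in> X 1" "q \<in> X 1" "p \<noteq> q" "\<not> p \<rightarrow>\<^bsub>C12 D\<^esub> q"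
    using not_competing_X1 verts unfolding competing12_def clique_def verts_C12 by blast
  consider (sink) s where "s \<in> X 1" "sink D s" | (no_sink) "\<not> sink D p" "\<not> sink D q"
    using pq by blast
  then show thesis
  proof cases
    case sink
    then show thesis using that[of s s] by (simp add: sink_iff_out_nbrs)
  next
    case no_sink
    have "anti_competing12 D {p, q}"
      using pq verts by (auto simp: anti_competing12_pair_iff)
    moreover have "{u \<in> {p, q}. \<not> sink D u} = {p, q}"
      using no_sink by auto
    ultimately have "out_nbrs D p \<union> out_nbrs D q \<subseteq> X 2"
      using labeling[of "{p, q}"] pq no_sink by simp
    moreover have "out_nbrs D p \<inter> out_nbrs D q = {}"
      using pq C12_adj_if_common_out_nbr by (auto simp: mem_out_nbrs_iff)
    ultimately show thesis using that pq by blast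
  qed
qed

lemma common_out_nbr_in_X1:
  assumes "u \<in> verts D - X 1" "v \<in> verts D - X 1" "u \<notin> X 2 \<or> v \<notin> X 2"
  shows "\<exists>w\<in>X 1. u \<rightarrow>\<^bsub>D\<^esub> w \<and> v \<rightarrow>\<^bsub>D\<^esub> w"
proof -
  obtain p q where pq: "p \<in> X 1" "q \<in> X 1"
      "out_nbrs D p \<inter> out_nbrs D q = {}" "out_nbrs D p \<union> out_nbrs D q \<subseteq> X 2"
    by (rule disjoint_out_nbrs_pair)
  then have "u \<notin> out_nbrs D p \<and> v \<notin> out_nbrs D p \<or> u \<notin> out_nbrs D q \<and> v \<notin> out_nbrs D q"
    using assms(3) by blast
  then show ?thesis
    using pq(1,2) assms(1,2) adj_to_part_iff[OF one_is_part_index] by blast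
qed

lemma out_nbrs_Int_X1_nonempty:
  assumes "v \<in> verts D - X 1"
  shows "out_nbrs D v \<inter> X 1 \<noteq> {}"
proof -
  obtain p q where pq: "p \<in> X 1" "q \<in> X 1" "out_nbrs D p \<inter> out_nbrs D q = {}"
    by (rule disjoint_out_nbrs_pair)
  then have "v \<notin> out_nbrs D p \<or> v \<notin> out_nbrs D q" by blast
  then show ?thesis
    using pq(1,2) adj_to_part_iff[OF one_is_part_index _ assms] unfolding out_nbrs_def by blast
qed

lemma C12_adj_outside_X1:
  assumes "u \<in> verts D - X 1" "v \<in> verts D - X 1" "u \<notin> X 2 \<or> v \<notin> X 2" "u \<noteq> v"
  shows "u \<rightarrow>\<^bsub>C12 D\<^esub> v"
  using common_out_nbr_in_X1[OF assms(1-3)] C12_adj_if_common_out_nbr[OF assms(4)] by blast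

lemma clique_Union_parts_from_3: "clique (C12 D) (\<Union>i\<in>{3..k}. X i)"
  using Union_parts_from_3_subset C12_adj_outside_X1 unfolding clique_def verts_C12 by blast

lemma C12_adj_part_from_3_X2:
  assumes "x \<in> (\<Union>i\<in>{3..k}. X i)" "y \<in> X 2"
  shows "x \<rightarrow>\<^bsub>C12 D\<^esub> y"
proof (rule C12_adj_outside_X1)
  show "x \<in> verts D - X 1" "x \<notin> X 2 \<or> y \<notin> X 2" "x \<noteq> y"
    using assms Union_parts_from_3_subset by auto
  have "2 \<in> {2..k}" using assms(1) by auto
  then show "y \<in> verts D - X 1"
    using assms(2) part_subset_verts_diff_X1 by blast
qed

lemma F_set_subset_X1:
  assumes "i \<in> {2..k}"
  shows "F_set D (X i) \<subseteq> X 1"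
proof
  fix v assume v: "v \<in> F_set D (X i)"
  have "out_nbrs D v \<inter> X 1 = {}"
    using v part_subset_verts_diff_X1[OF assms] by (auto simp: F_set_def)
  then show "v \<in> X 1"
    using v out_nbrs_Int_X1_nonempty[of v] by (auto simp: F_set_def)
qed

lemma C12_adj_F_set_F_set:
  assumes "i \<in> {2..k}" "j \<in> {2..k}" "i \<noteq> j" "x \<in> F_set D (X i)" "y \<in> F_set D (X j)"
  shows "x \<rightarrow>\<^bsub>C12 D\<^esub> y"
proof -
  obtain a where a: "a \<in> out_nbrs D x" "a \<in> X i" using assms(4) by (auto simp: F_set_def)
  obtain b where b: "b \<in> out_nbrs D y" "b \<in> X j" using assms(5) by (auto simp: F_set_def)
  have i: "i \<in> {1..k}" and "j \<in> {1..k}"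
    using assms(1,2) by auto
  then have disjoint: "X j \<subseteq> verts D - X i"
    using assms(3) by (intro part_subset_verts_diff_part) auto
  have "x \<noteq> y"
    using a assms(5) disjoint by (auto simp: F_set_def)
  moreover have "x \<in> X 1" "y \<in> X 1"
    using F_set_subset_X1 assms by blast+
  then have "a \<noteq> y" "b \<noteq> x"
    using a(2) b(2) assms(1,2) part_subset_verts_diff_X1 by blast+
  ultimately show ?thesis
    using C12_adj_if_out_nbrs_diff_parts[OF _ i] a b disjoint by blast
qed

lemma C12_adj_F_set_part:
  assumes "i \<in> {2..k}" "j \<in> {2..k}" "i \<noteq> j" "x \<in> F_set D (X i)" "y \<in> X j"
  shows "x \<rightarrow>\<^bsub>C12 D\<^esub> y"
proof -
  obtain a where a: "a \<in> out_nbrs D x" "a \<in> X i" using assms(4) by (auto simp: F_set_def)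
  have i: "i \<in> {1..k}" and "j \<in> {1..k}"
    using assms(1,2) by auto
  then have disjoint: "X j \<subseteq> verts D - X i"
    using assms(3) by (intro part_subset_verts_diff_part) auto
  have outside: "a \<in> verts D - X 1" "y \<in> verts D - X 1"
    using a(2) assms(1,2,5) part_subset_verts_diff_X1 by blast+
  have "a \<notin> X 2 \<or> y \<notin> X 2"
    using a(2) assms(1-3,5) part_subset_verts_diff_part[of i 2] part_subset_verts_diff_part[of j 2]
    by (cases "i = 2") auto
  then obtain w where w: "w \<in> X 1" "a \<rightarrow>\<^bsub>D\<^esub> w" "y \<rightarrow>\<^bsub>D\<^esub> w"
    using common_out_nbr_in_X1[OF outside] by blast
  have "w \<noteq> x"
    using w(2) a(1) adj_asym by (auto simp: mem_out_nbrs_iff)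
  moreover have "w \<in> verts D - X i"
    using out_nbrs_subset_verts_diff_part[OF i a(2)] w(2) unfolding out_nbrs_def by blast
  moreover have "x \<noteq> y" "a \<noteq> y"
    using F_set_subset_X1[OF assms(1)] assms(4,5) outside a(2) disjoint by blast+
  ultimately show ?thesis
    using C12_adj_if_out_nbrs_diff_parts[OF _ i] a w(3) by (auto simp: mem_out_nbrs_iff)
qed

lemma not_C12_adj_F_set_iff:
  assumes "i \<in> {2..k}" "x \<in> F_set D (X i)" "y \<in> X i"
  shows "\<not> x \<rightarrow>\<^bsub>C12 D\<^esub> y \<longleftrightarrow> out_nbrs D x = {y} \<or> out_nbrs D y = {x}"
proof
  assume "out_nbrs D x = {y} \<or> out_nbrs D y = {x}"
  then show "\<not> x \<rightarrow>\<^bsub>C12 D\<^esub> y"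
    unfolding C12_adj_iff by blast
next
  assume nonadjacent: "\<not> x \<rightarrow>\<^bsub>C12 D\<^esub> y"
  have i: "i \<in> {1..k}" using assms(1) by auto
  have y: "y \<in> verts D - X 1"
    using assms(1,3) part_subset_verts_diff_X1 by blast
  then have "x \<noteq> y"
    using F_set_subset_X1[OF assms(1)] assms(2) by blast
  have "out_nbrs D x \<subseteq> X i" "out_nbrs D y \<subseteq> verts D - X i"
    using assms(2) out_nbrs_subset_verts_diff_part[OF i assms(3)] by (auto simp: F_set_def)
  then have "out_nbrs D x - {y} = {} \<or> out_nbrs D y - {x} = {}"
    using nonadjacent C12_adj_if_out_nbrs_diff_parts[OF \<open>x \<noteq> y\<close> i] by blast
  moreover have "out_nbrs D x \<noteq> {}" "out_nbrs D y \<noteq> {}"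
    using assms(2) out_nbrs_Int_X1_nonempty[OF y] by (auto simp: F_set_def)
  ultimately show "out_nbrs D x = {y} \<or> out_nbrs D y = {x}" by blast
qed

lemma clique_verts_diff_X1:
  assumes "(\<exists>v\<in>verts D. sink D v) \<or> (\<exists>S\<subseteq>X 1. anti_competing12 D S \<and> card S \<ge> 3)"
  shows "clique (C12 D) (verts D - X 1)"
  using assms
proof (elim disjE bexE exE conjE)
  fix s assume "sink D s"
  moreover from this have "s \<in> X 1"
    by (rule sink_in_noncompeting_part[OF one_is_part_index not_competing_X1])
  ultimately show ?thesis
    by (rule clique_verts_diff_part_if_sink[OF one_is_part_index])
next
  fix S assume "S \<subseteq> X 1" "anti_competing12 D S" "card S \<ge> 3"
  then show ?thesis
    by (rule clique_verts_diff_part_if_anti_competing[OF one_is_part_index])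
qed

end

theorem theorem3p3:
  fixes D :: "('a, 'b) pre_digraph" and k :: nat and X :: "nat \<Rightarrow> 'a set"
  assumes "k \<ge> 3"
    and "loose k X D"
    and "\<not> competing12 D (X 1)"
    and "\<And>S v. \<lbrakk>S \<subseteq> X 1; anti_competing12 D S; card {u \<in> S. \<not> sink D u} \<ge> 2;
           v \<in> S; \<not> sink D v\<rbrakk> \<Longrightarrow> out_nbrs D v \<subseteq> X 2"
  shows "(\<forall>i\<in>{2..k}. F_set D (X i) \<subseteq> X 1)
    \<and> (clique (C12 D) (\<Union>i\<in>{3..k}. X i)
         \<and> (\<forall>x\<in>(\<Union>i\<in>{3..k}. X i). \<forall>y\<in>X 2. x \<rightarrow>\<^bsub>C12 D\<^esub> y))
    \<and> (\<forall>i\<in>{2..k}. \<forall>j\<in>{2..k}. i \<noteq> j \<longrightarrow>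
         (\<forall>x\<in>F_set D (X i). \<forall>y\<in>F_set D (X j) \<union> X j. x \<rightarrow>\<^bsub>C12 D\<^esub> y))
    \<and> (\<forall>i\<in>{2..k}. \<forall>x\<in>verts D. \<forall>y\<in>X i. \<not> sink D x \<and> out_nbrs D x \<subseteq> X i \<longrightarrow>
         (\<not> x \<rightarrow>\<^bsub>C12 D\<^esub> y \<longleftrightarrow> out_nbrs D x = {y} \<or> out_nbrs D y = {x}))
    \<and> ((\<exists>v\<in>verts D. sink D v) \<or> (\<exists>S\<subseteq>X 1. anti_competing12 D S \<and> card S \<ge> 3) \<longrightarrow>
         clique (C12 D) (verts D - X 1))"
proof -
  interpret partite_tournament_digraph D k X
    using assms(2) by unfold_locales (simp add: loose_def multipartite_tournament_def)
  interpret labeled_loose D k X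
    using assms(1,3,4) by unfold_locales auto
  show ?thesis
  proof (intro conjI ballI impI)
    fix i x y assume "i \<in> {2..k}" "x \<in> verts D" "y \<in> X i" "\<not> sink D x \<and> out_nbrs D x \<subseteq> X i"
    then show "\<not> x \<rightarrow>\<^bsub>C12 D\<^esub> y \<longleftrightarrow> out_nbrs D x = {y} \<or> out_nbrs D y = {x}"
      by (intro not_C12_adj_F_set_iff) (auto simp: F_set_def sink_iff_out_nbrs)
  next
    fix i j x y
    assume "i \<in> {2..k}" "j \<in> {2..k}" "i \<noteq> j" "x \<in> F_set D (X i)" "y \<in> F_set D (X j) \<union> X j"
    then show "x \<rightarrow>\<^bsub>C12 D\<^esub> y"
      using C12_adj_F_set_F_set C12_adj_F_set_part by blast
  qed (fact F_set_subset_X1 clique_Union_parts_from_3 C12_adj_part_from_3_X2 clique_verts_diff_X1)+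
qed

end
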